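(* Let $S$ be a semiring and $A$ an $S$-semialgebra. Suppose that the $S$-semimodule $A$ is a Jónsson $S$-semimodule. Then each element of $A$ is either a unit or multiplicatively non-cancellative.
   Context: A semiring is an algebraic structure $(S,+,\cdot,0,1)$ such that $(S,+,0)$ and $(S,\cdot,1)$ are commutative monoids, multiplication distributes over addition, and $s\cdot 0=0$ for all $s\in S$. An $S$-semimodule is a commutative monoid $(M,+,0_M)$ with a scalar multiplication $S\times M\to M$ such that for all $s,t\in S$ and $m,n\in M$: $s(m+n)=sm+sn$; $(s+t)m=sm+tm$; $(st)m=s(tm)$; $s0_M=0_M$; $0_S m=0_M$; $1m=m$. An $S$-semialgebra is an $S$-semimodule $A$ together with a multiplication making $(A,\cdot)$ a commutative monoid (with identity $1$) that distributes over the addition of $A$ and satisfies $\alpha(a\cdot b)=(\alpha a)\cdot b=a\cdot(\alpha b)$ for all $\alpha\in S$ and $a,b\in A$. An $S$-subsemimodule of $M$ is a submonoid of $(M,+,0_M)$ closed under scalar multiplication; it is proper if it is not equal to $M$. An $S$-semimodule $M$ is a Jónsson $S$-semimodule if $|N|<|M|$ (cardinalities) for each proper $S$-subsemimodule $N$ of $M$. An element $a\in A$ is a unit if $ab=1$ for some $b\in A$; it is multiplicatively cancellative if $ax_1=ax_2$ implies $x_1=x_2$ for all $x_1,x_2\in A$, and multiplicatively non-cancellative otherwise. *)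

theory Defs
  imports "HOL-Algebra.Module" "HOL-Library.Equipollence"
begin

locale csemiring = semiring S + comm_monoid S for S (structure)

text \<open>
  The semimodule axioms use only the additive structure and the scalar multiplication of
  the record \<open>M\<close>; its multiplicative fields are unconstrained here, as in the library
  locale \<^locale>\<open>module\<close>.
\<close>

locale semimodule = S?: csemiring S + M?: abelian_monoid M
  for S (structure) and M (structure) +
  assumes smult_closed [simp, intro]:
      "\<lbrakk>s \<in> carrier S; m \<in> carrier M\<rbrakk> \<Longrightarrow> s \<odot>\<^bsub>M\<^esub> m \<in> carrier M"
    and smult_r_distr:
      "\<lbrakk>s \<in> carrier S; m \<in> carrier M; n \<in> carrier M\<rbrakk> \<Longrightarrow>
        s \<odot>\<^bsub>M\<^esub> (m \<oplus>\<^bsub>M\<^esub> n) = s \<odot>\<^bsub>M\<^esub> m \<oplus>\<^bsub>M\<^esub> s \<odot>\<^bsub>M\<^esub> n"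
    and smult_l_distr:
      "\<lbrakk>s \<in> carrier S; t \<in> carrier S; m \<in> carrier M\<rbrakk> \<Longrightarrow>
        (s \<oplus>\<^bsub>S\<^esub> t) \<odot>\<^bsub>M\<^esub> m = s \<odot>\<^bsub>M\<^esub> m \<oplus>\<^bsub>M\<^esub> t \<odot>\<^bsub>M\<^esub> m"
    and smult_assoc1:
      "\<lbrakk>s \<in> carrier S; t \<in> carrier S; m \<in> carrier M\<rbrakk> \<Longrightarrow>
        (s \<otimes>\<^bsub>S\<^esub> t) \<odot>\<^bsub>M\<^esub> m = s \<odot>\<^bsub>M\<^esub> (t \<odot>\<^bsub>M\<^esub> m)"
    and smult_r_null [simp]:
      "s \<in> carrier S \<Longrightarrow> s \<odot>\<^bsub>M\<^esub> \<zero>\<^bsub>M\<^esub> = \<zero>\<^bsub>M\<^esub>"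
    and smult_l_null [simp]:
      "m \<in> carrier M \<Longrightarrow> \<zero>\<^bsub>S\<^esub> \<odot>\<^bsub>M\<^esub> m = \<zero>\<^bsub>M\<^esub>"
    and smult_one [simp]:
      "m \<in> carrier M \<Longrightarrow> \<one>\<^bsub>S\<^esub> \<odot>\<^bsub>M\<^esub> m = m"

text \<open>
  Right distributivity follows from commutativity of the multiplication, and \<open>\<zero> \<otimes> a = \<zero>\<close>
  in \<open>A\<close> follows from the compatibility with scalars.
\<close>

locale semialgebra = semimodule S A + A?: comm_monoid A
  for S (structure) and A (structure) +
  assumes mult_l_distr:
      "\<lbrakk>a \<in> carrier A; b \<in> carrier A; c \<in> carrier A\<rbrakk> \<Longrightarrow>
        (a \<oplus>\<^bsub>A\<^esub> b) \<otimes>\<^bsub>A\<^esub> c = a \<otimes>\<^bsub>A\<^esub> c \<oplus>\<^bsub>A\<^esub> b \<otimes>\<^bsub>A\<^esub> c"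
    and smult_mult_left:
      "\<lbrakk>s \<in> carrier S; a \<in> carrier A; b \<in> carrier A\<rbrakk> \<Longrightarrow>
        s \<odot>\<^bsub>A\<^esub> (a \<otimes>\<^bsub>A\<^esub> b) = (s \<odot>\<^bsub>A\<^esub> a) \<otimes>\<^bsub>A\<^esub> b"
    and smult_mult_right:
      "\<lbrakk>s \<in> carrier S; a \<in> carrier A; b \<in> carrier A\<rbrakk> \<Longrightarrow>
        s \<odot>\<^bsub>A\<^esub> (a \<otimes>\<^bsub>A\<^esub> b) = a \<otimes>\<^bsub>A\<^esub> (s \<odot>\<^bsub>A\<^esub> b)"

definition subsemimodule ::
    "'b set \<Rightarrow> ('a, 'm) ring_scheme \<Rightarrow> ('a, 'b, 'n) module_scheme \<Rightarrow> bool" where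
  "subsemimodule N S M \<longleftrightarrow>
     submonoid N (add_monoid M) \<and> (\<forall>s \<in> carrier S. \<forall>n \<in> N. s \<odot>\<^bsub>M\<^esub> n \<in> N)"

locale jonsson_semimodule = semimodule S M for S (structure) and M (structure) +
  assumes proper_smaller:
    "\<lbrakk>subsemimodule N S M; N \<noteq> carrier M\<rbrakk> \<Longrightarrow> N \<prec> carrier M"

definition mult_cancellative :: "('a, 'm) monoid_scheme \<Rightarrow> 'a \<Rightarrow> bool" where
  "mult_cancellative A a \<longleftrightarrow>
     (\<forall>x \<in> carrier A. \<forall>y \<in> carrier A. a \<otimes>\<^bsub>A\<^esub> x = a \<otimes>\<^bsub>A\<^esub> y \<longrightarrow> x = y)"

end

theory Submission
  imports Defs
begin

text \<open>
  Multiplication by \<open>a\<close> is an endomorphism of the semimodule \<open>A\<close>, so its image \<open>aA\<close> is a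
  subsemimodule. If \<open>a\<close> is multiplicatively cancellative, this endomorphism is injective, and
  \<open>aA\<close> has the cardinality of \<open>A\<close>. The Jonsson property excludes proper subsemimodules of
  full cardinality, hence \<open>aA = A\<close>; in particular \<open>1 \<in> aA\<close>, which makes \<open>a\<close> a unit.
\<close>

context semialgebra
begin

text \<open>
  Additive inverses are not available, so annihilation by zero cannot come from
  distributivity; it comes from writing \<open>0\<close> as the scalar multiple \<open>0 \<odot> 0\<close> and moving the
  scalar out of the product.
\<close>
lemma mult_r_null:
  assumes a: "a \<in> carrier A"
  shows "a \<otimes>\<^bsub>A\<^esub> \<zero>\<^bsub>A\<^esub> = \<zero>\<^bsub>A\<^esub>"
proof -
  have "a \<otimes>\<^bsub>A\<^esub> \<zero>\<^bsub>A\<^esub> = a \<otimes>\<^bsub>A\<^esub> (\<zero>\<^bsub>S\<^esub> \<odot>\<^bsub>A\<^esub> \<zero>\<^bsub>A\<^esub>)"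
    by simp
  also have "\<dots> = \<zero>\<^bsub>S\<^esub> \<odot>\<^bsub>A\<^esub> (a \<otimes>\<^bsub>A\<^esub> \<zero>\<^bsub>A\<^esub>)"
    using a by (simp add: smult_mult_right)
  also have "\<dots> = \<zero>\<^bsub>A\<^esub>"
    using a by simp
  finally show ?thesis .
qed

lemma mult_r_distr:
  assumes "a \<in> carrier A" "b \<in> carrier A" "c \<in> carrier A"
  shows "a \<otimes>\<^bsub>A\<^esub> (b \<oplus>\<^bsub>A\<^esub> c) = a \<otimes>\<^bsub>A\<^esub> b \<oplus>\<^bsub>A\<^esub> a \<otimes>\<^bsub>A\<^esub> c"
  using assms by (simp add: mult_l_distr A.m_comm [of a])

lemma subsemimodule_image_mult:
  assumes a: "a \<in> carrier A"
  shows "subsemimodule ((\<lambda>x. a \<otimes>\<^bsub>A\<^esub> x) ` carrier A) S A"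
  unfolding subsemimodule_def
proof (intro conjI ballI)
  let ?aA = "(\<lambda>x. a \<otimes>\<^bsub>A\<^esub> x) ` carrier A"
  show "submonoid ?aA (add_monoid A)"
  proof
    show "?aA \<subseteq> carrier (add_monoid A)"
      using a by auto
    show "\<one>\<^bsub>add_monoid A\<^esub> \<in> ?aA"
      using mult_r_null [OF a] by (auto intro!: image_eqI [where x = "\<zero>\<^bsub>A\<^esub>"])
  next
    fix u v assume "u \<in> ?aA" "v \<in> ?aA"
    then obtain x y where "x \<in> carrier A" "y \<in> carrier A" "u = a \<otimes>\<^bsub>A\<^esub> x" "v = a \<otimes>\<^bsub>A\<^esub> y"
      by blast
    then show "u \<otimes>\<^bsub>add_monoid A\<^esub> v \<in> ?aA"
      using a by (auto simp: mult_r_distr intro!: image_eqI [where x = "x \<oplus>\<^bsub>A\<^esub> y"])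
  qed
next
  fix s u assume s: "s \<in> carrier S" and "u \<in> (\<lambda>x. a \<otimes>\<^bsub>A\<^esub> x) ` carrier A"
  then obtain x where "x \<in> carrier A" "u = a \<otimes>\<^bsub>A\<^esub> x"
    by blast
  then show "s \<odot>\<^bsub>A\<^esub> u \<in> (\<lambda>x. a \<otimes>\<^bsub>A\<^esub> x) ` carrier A"
    using a s by (auto simp: smult_mult_right intro!: image_eqI [where x = "s \<odot>\<^bsub>A\<^esub> x"])
qed

end

lemma inj_on_mult_iff_mult_cancellative:
  "inj_on (\<lambda>x. a \<otimes>\<^bsub>A\<^esub> x) (carrier A) \<longleftrightarrow> mult_cancellative A a"
  by (auto simp: inj_on_def mult_cancellative_def)

lemma (in jonsson_semimodule) subsemimodule_eqpoll_imp_eq: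
  assumes "subsemimodule N S M" "N \<approx> carrier M"
  shows "N = carrier M"
  using assms proper_smaller by (auto simp: lesspoll_def)

theorem corollary2p6:
  fixes S :: "('s, 'm) ring_scheme" and A :: "('s, 'a, 'n) module_scheme"
  assumes "semialgebra S A"
    and "jonsson_semimodule S A"
  shows "\<forall>a \<in> carrier A. a \<in> Units A \<or> \<not> mult_cancellative A a"
proof -
  interpret semialgebra S A by fact
  interpret J: jonsson_semimodule S A by fact
  have "a \<in> Units A" if a: "a \<in> carrier A" and canc: "mult_cancellative A a" for a
  proof -
    have "(\<lambda>x. a \<otimes>\<^bsub>A\<^esub> x) ` carrier A \<approx> carrier A"
      using canc by (intro inj_on_image_eqpoll_self) (simp add: inj_on_mult_iff_mult_cancellative)
    then have "(\<lambda>x. a \<otimes>\<^bsub>A\<^esub> x) ` carrier A = carrier A"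
      using J.subsemimodule_eqpoll_imp_eq subsemimodule_image_mult [OF a] by blast
    then obtain b where b: "b \<in> carrier A" "a \<otimes>\<^bsub>A\<^esub> b = \<one>\<^bsub>A\<^esub>"
      using A.one_closed by (metis imageE)
    then show ?thesis
      using a A.m_comm [of a b] by (auto simp: Units_def)
  qed
  then show ?thesis by blast
qed

end
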